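(* Let $I\subset(0,\infty)$ be an interval, let $f:I\to\mathbb{R}$ be a differentiable function on the interior $I^\circ$, let $a,b\in I$ with $a<b$, and let $f'\in L[a,b]$. Let $\alpha>0$, $s\in(0,1]$, $q>1$ and $\frac1p+\frac1q=1$. If $|f'|^q$ is harmonically $s$-convex on $[a,b]$, then for all $x\in[a,b]$, $$|S_f(g;\alpha;x,a,b)|\le\left(\frac{1}{\alpha p+1}\right)^{\frac1p}\Bigg\{\frac{(x-a)^{\alpha+1}}{(ax)^{\alpha-1}}\Big(\lambda_1(a,x,s,q,0)|f'(x)|^q+\lambda_2(a,x,s,q,0)|f'(a)|^q\Big)^{\frac1q}+\frac{(b-x)^{\alpha+1}}{(bx)^{\alpha-1}}\Big(\lambda_3(b,x,s,q,0)|f'(x)|^q+\lambda_4(b,x,s,q,0)|f'(b)|^q\Big)^{\frac1q}\Bigg\}.$$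
   Context: A function $h:K\to\mathbb{R}$ on an interval $K\subset(0,\infty)$ is harmonically $s$-convex ($s\in(0,1]$ fixed) if $h\left(\frac{uv}{tu+(1-t)v}\right)\le t^s h(v)+(1-t)^s h(u)$ for all $u,v\in K$, $t\in[0,1]$. With $g(u)=1/u$, $$S_f(g;\alpha;x,a,b)=\left[\left(\frac{x-a}{ax}\right)^{\alpha}+\left(\frac{b-x}{bx}\right)^{\alpha}\right]f(x)-\Gamma(\alpha+1)\left\{J_{1/x-}^{\alpha}(f\circ g)(1/b)+J_{1/x+}^{\alpha}(f\circ g)(1/a)\right\},$$ where $\Gamma$ is the Gamma function and the Riemann–Liouville fractional integrals are $J_{c+}^{\alpha}h(y)=\frac{1}{\Gamma(\alpha)}\int_c^y(y-t)^{\alpha-1}h(t)\,dt$ ($y>c$) and $J_{d-}^{\alpha}h(y)=\frac{1}{\Gamma(\alpha)}\int_y^d(t-y)^{\alpha-1}h(t)\,dt$ ($y<d$); an integral over a degenerate interval (when $x=a$ or $x=b$) is $0$. Beta function: $\beta(u,v)=\int_0^1t^{u-1}(1-t)^{v-1}dt$ for $u,v>0$. Hypergeometric function: ${}_2F_1(A,B;C;z)=\frac{1}{\beta(B,C-B)}\int_0^1t^{B-1}(1-t)^{C-B-1}(1-zt)^{-A}dt$ for $C>B>0$, $|z|<1$. Define $$\lambda_1(a,x,s,\vartheta,\rho)=\frac{\beta(\rho+s+1,1)}{x^{2\vartheta}}\,{}_2F_1\!\left(2\vartheta,\rho+s+1;\rho+s+2;1-\tfrac ax\right),$$ $$\lambda_2(a,x,s,\vartheta,\rho)=\frac{\beta(\rho+1,s+1)}{x^{2\vartheta}}\,{}_2F_1\!\left(2\vartheta,\rho+1;\rho+s+2;1-\tfrac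 ax\right),$$ $$\lambda_3(b,x,s,\vartheta,\rho)=\frac{\beta(1,\rho+s+1)}{b^{2\vartheta}}\,{}_2F_1\!\left(2\vartheta,1;\rho+s+2;1-\tfrac xb\right),$$ $$\lambda_4(b,x,s,\vartheta,\rho)=\frac{\beta(s+1,\rho+1)}{b^{2\vartheta}}\,{}_2F_1\!\left(2\vartheta,s+1;\rho+s+2;1-\tfrac xb\right).$$ $L[a,b]$ denotes the integrable functions on $[a,b]$. The derivative $f'$ is regarded as a function on $[a,b]$; if $a$ or $b$ is an endpoint of $I$, $f'$ there is the one-sided derivative. *)

theory Defs
  imports "HOL-Analysis.Analysis"
begin

(* Meant for K an interval of positive reals and 0 < s \<le> 1; note 0 powr s = 0. *)
definition harmonically_s_convex_on :: "real \<Rightarrow> real set \<Rightarrow> (real \<Rightarrow> real) \<Rightarrow> bool" where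
  "harmonically_s_convex_on s K h \<longleftrightarrow>
     (\<forall>u\<in>K. \<forall>v\<in>K. \<forall>t\<in>{0..1}.
        h (u * v / (t * u + (1 - t) * v)) \<le> t powr s * h v + (1 - t) powr s * h u)"

(* Riemann-Liouville fractional integrals: J\<^sub>c\<^sub>+ for c \<le> y and J\<^sub>d\<^sub>- for y \<le> d.
   Over a degenerate interval the value is 0. *)
definition RL_left :: "real \<Rightarrow> real \<Rightarrow> (real \<Rightarrow> real) \<Rightarrow> real \<Rightarrow> real" where
  "RL_left \<alpha> c h y = 1 / Gamma \<alpha> * (LBINT t:{c..y}. (y - t) powr (\<alpha> - 1) * h t)"

definition RL_right :: "real \<Rightarrow> real \<Rightarrow> (real \<Rightarrow> real) \<Rightarrow> real \<Rightarrow> real" where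
  "RL_right \<alpha> d h y = 1 / Gamma \<alpha> * (LBINT t:{y..d}. (t - y) powr (\<alpha> - 1) * h t)"

(* Used with g = (\<lambda>u. 1 / u). *)
definition S_func ::
    "(real \<Rightarrow> real) \<Rightarrow> (real \<Rightarrow> real) \<Rightarrow> real \<Rightarrow> real \<Rightarrow> real \<Rightarrow> real \<Rightarrow> real" where
  "S_func f g \<alpha> x a b =
     (((x - a) / (a * x)) powr \<alpha> + ((b - x) / (b * x)) powr \<alpha>) * f x
     - Gamma (\<alpha> + 1) *
       (RL_right \<alpha> (1 / x) (f \<circ> g) (1 / b) + RL_left \<alpha> (1 / x) (f \<circ> g) (1 / a))"

(* Gauss hypergeometric function for C > B > 0 and \<bar>z\<bar> < 1, by Euler's integral.
   Beta is the library's beta function; has_integral_Beta_real gives its integral form. *)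
definition hypergeom_2F1 :: "real \<Rightarrow> real \<Rightarrow> real \<Rightarrow> real \<Rightarrow> real" where
  "hypergeom_2F1 A B C z =
     1 / Beta B (C - B) *
       (LBINT t:{0..1}. t powr (B - 1) * (1 - t) powr (C - B - 1) * (1 - z * t) powr (- A))"

definition lambda1 :: "real \<Rightarrow> real \<Rightarrow> real \<Rightarrow> real \<Rightarrow> real \<Rightarrow> real" where
  "lambda1 a x s \<theta> \<rho> =
     Beta (\<rho> + s + 1) 1 / x powr (2 * \<theta>)
       * hypergeom_2F1 (2 * \<theta>) (\<rho> + s + 1) (\<rho> + s + 2) (1 - a / x)"

definition lambda2 :: "real \<Rightarrow> real \<Rightarrow> real \<Rightarrow> real \<Rightarrow> real \<Rightarrow> real" where
  "lambda2 a x s \<theta> \<rho> =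
     Beta (\<rho> + 1) (s + 1) / x powr (2 * \<theta>)
       * hypergeom_2F1 (2 * \<theta>) (\<rho> + 1) (\<rho> + s + 2) (1 - a / x)"

definition lambda3 :: "real \<Rightarrow> real \<Rightarrow> real \<Rightarrow> real \<Rightarrow> real \<Rightarrow> real" where
  "lambda3 b x s \<theta> \<rho> =
     Beta 1 (\<rho> + s + 1) / b powr (2 * \<theta>)
       * hypergeom_2F1 (2 * \<theta>) 1 (\<rho> + s + 2) (1 - x / b)"

definition lambda4 :: "real \<Rightarrow> real \<Rightarrow> real \<Rightarrow> real \<Rightarrow> real \<Rightarrow> real" where
  "lambda4 b x s \<theta> \<rho> =
     Beta (s + 1) (\<rho> + 1) / b powr (2 * \<theta>)
       * hypergeom_2F1 (2 * \<theta>) (s + 1) (\<rho> + s + 2) (1 - x / b)"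

end

theory Submission
  imports Defs
begin

text \<open>
  For an endpoint \<open>c\<close> (either \<open>a\<close> or \<open>b\<close>) let \<open>u t = c x / (t c + (1 - t) x)\<close>, the path from \<open>c\<close>
  to \<open>x\<close> whose reciprocal is affine. Substituting \<open>\<tau> = 1 / u t\<close> and integrating by parts turns
  the part of \<open>S_f\<close> belonging to \<open>c\<close> into a multiple of
  \<open>\<integral>\<^sub>0\<^sup>1 t\<^sup>\<alpha> f'(u t) / (t c + (1 - t) x)\<^sup>2 dt\<close>. Harmonic convexity bounds \<open>\<bar>f'(u t)\<bar>\<^sup>q\<close> by
  \<open>t\<^sup>s \<bar>f'(x)\<bar>\<^sup>q + (1 - t)\<^sup>s \<bar>f'(c)\<bar>\<^sup>q\<close>, and Hoelder's inequality separates the factor \<open>t\<^sup>\<alpha>\<close>; the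
  remaining integrals are Euler integrals for \<open>\<lambda>\<^sub>1, ..., \<lambda>\<^sub>4\<close>.
\<close>

section \<open>Hoelder's inequality for Henstock-Kurzweil integrals\<close>

text \<open>Young's inequality is applied pointwise to the two factors, each divided by its slightly
  enlarged norm, and then integrated.\<close>

lemma Holder_inequality_integral:
  fixes g h :: "'a::euclidean_space \<Rightarrow> real"
  assumes pq: "p > 1" "q > 1" "1 / p + 1 / q = 1"
    and gh: "(\<lambda>t. g t * h t) integrable_on S"
    and g: "(\<lambda>t. g t powr p) integrable_on S" and h: "(\<lambda>t. h t powr q) integrable_on S"
    and nn: "\<And>t. t \<in> S \<Longrightarrow> 0 \<le> g t" "\<And>t. t \<in> S \<Longrightarrow> 0 \<le> h t"
  shows "integral S (\<lambda>t. g t * h t)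
           \<le> integral S (\<lambda>t. g t powr p) powr (1 / p) * integral S (\<lambda>t. h t powr q) powr (1 / q)"
proof -
  define P Q where "P = integral S (\<lambda>t. g t powr p)" and "Q = integral S (\<lambda>t. h t powr q)"
  have PQ: "0 \<le> P" "0 \<le> Q"
    unfolding P_def Q_def by (intro integral_nonneg g h; simp)+
  \<comment> \<open>Replacing \<open>P, Q\<close> by \<open>P + e, Q + e\<close> avoids a case distinction on vanishing norms.\<close>
  have le: "integral S (\<lambda>t. g t * h t) \<le> (P + e) powr (1 / p) * (Q + e) powr (1 / q)"
    if "e > 0" for e
  proof -
    have pos: "P + e > 0" "Q + e > 0" using PQ that by auto
    let ?G = "(P + e) powr (1 / p)" and ?H = "(Q + e) powr (1 / q)"
    have GH: "?G > 0" "?H > 0" using pos by auto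
    have "integral S (\<lambda>t. g t * h t)
        \<le> integral S (\<lambda>t. ?G * ?H / (p * (P + e)) * g t powr p + ?G * ?H / (q * (Q + e)) * h t powr q)"
    proof (rule integral_le)
      fix t assume t: "t \<in> S"
      have "(g t / ?G) * (h t / ?H) \<le> (g t / ?G) powr p / p + (h t / ?H) powr q / q"
        using Youngs_inequality[of p q "g t / ?G" "h t / ?H"] pq nn[OF t] GH by auto
      also have "\<dots> = g t powr p / (p * (P + e)) + h t powr q / (q * (Q + e))"
        using pq nn[OF t] pos by (simp add: powr_divide powr_powr field_simps)
      finally have "?G * ?H * ((g t / ?G) * (h t / ?H))
          \<le> ?G * ?H * (g t powr p / (p * (P + e)) + h t powr q / (q * (Q + e)))"
        using GH by (intro mult_left_mono) auto
      then show "g t * h t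
          \<le> ?G * ?H / (p * (P + e)) * g t powr p + ?G * ?H / (q * (Q + e)) * h t powr q"
        using GH by (simp add: algebra_simps)
    qed (intro gh g h integrable_add integrable_on_mult_right)+
    also have "\<dots> = ?G * ?H / (p * (P + e)) * P + ?G * ?H / (q * (Q + e)) * Q"
      unfolding P_def Q_def
      by (subst integral_add) (intro g h integrable_on_mult_right | simp only: integral_mult_right)+
    also have "\<dots> = ?G * ?H * (1 / p * (P / (P + e)) + 1 / q * (Q / (Q + e)))"
      by (simp add: algebra_simps)
    \<comment> \<open>Both fractions are at most 1; the weights then sum to 1 by conjugacy.\<close>
    also have "\<dots> \<le> ?G * ?H * (1 / p * 1 + 1 / q * 1)"
      using GH pos that pq by (intro mult_left_mono add_mono) auto
    finally show ?thesis using pq by simp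
  qed
  \<comment> \<open>Let e decrease to 0. Vanishing \<open>P\<close> or \<open>Q\<close> does no
    harm, because the exponents are positive and the bases nonnegative.\<close>
  have "((\<lambda>e. (P + e) powr (1 / p) * (Q + e) powr (1 / q))
      \<longlongrightarrow> (P + 0) powr (1 / p) * (Q + 0) powr (1 / q)) (at_right 0)"
    by (intro tendsto_intros)
       (use pq PQ in \<open>auto simp: eventually_at_filter intro!: always_eventually\<close>)
  then show ?thesis
    unfolding P_def[symmetric] Q_def[symmetric]
    by (intro tendsto_lowerbound[where F = "at_right 0"])
       (auto simp: eventually_at_filter le intro!: always_eventually)
qed

section \<open>Euler integrals for the lambda coefficients\<close>

text \<open>The Beta factor in each lambda cancels the normalisation of the hypergeometric function;
  it is nonzero because Gamma does not vanish at positive arguments.\<close>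

lemma hypergeom_2F1_Euler:
  assumes "C > B" "B > 0"
  shows "Beta B (C - B) * hypergeom_2F1 A B C z =
    (LBINT t:{0..1}. t powr (B - 1) * (1 - t) powr (C - B - 1) * (1 - z * t) powr (- A))"
proof -
  have "B \<notin> \<int>\<^sub>\<le>\<^sub>0" "C - B \<notin> \<int>\<^sub>\<le>\<^sub>0" "C \<notin> \<int>\<^sub>\<le>\<^sub>0" using assms by (auto elim!: nonpos_Ints_cases)
  then have "Beta B (C - B) \<noteq> 0"
    by (simp add: Beta_def Gamma_eq_zero_iff)
  then show ?thesis by (simp add: hypergeom_2F1_def)
qed

text \<open>Used for \<open>lambda3\<close> and \<open>lambda4\<close>, whose Euler integrals run in
  the opposite direction.\<close>

lemma set_lborel_integral_reflect:
  fixes g :: "real \<Rightarrow> real"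
  shows "(LBINT t:{0..1}. g (1 - t)) = (LBINT t:{0..1}. g t)"
proof -
  have "indicator {0..1} (1 - t) = (indicator {0..1} t :: real)" for t :: real
    by (auto simp: indicator_def)
  then show ?thesis
    unfolding set_lebesgue_integral_def
    by (subst (2) lborel_integral_real_affine[of "-1" _ 1]) auto
qed

text \<open>The endpoints are exempted because \<open>0 powr 0 = 0\<close>: for \<rho> = 0 one Euler
  factor has exponent 0 and equals 1 only away from its zero. Two points are a null set.\<close>

lemma set_lborel_integral_eq_integral_continuous:
  fixes g h :: "real \<Rightarrow> real"
  assumes "continuous_on {0..1} h" and [measurable]: "g \<in> borel_measurable borel" "h \<in> borel_measurable borel"
    and "\<And>t. 0 < t \<Longrightarrow> t < 1 \<Longrightarrow> g t = h t"
  shows "(LBINT t:{0..1}. g t) = integral {0..1} h"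
proof -
  have "AE t in lborel. t \<noteq> 0 \<and> t \<noteq> (1::real)"
    using AE_lborel_singleton[of 0] AE_lborel_singleton[of "1::real"] by eventually_elim auto
  then have "AE t\<in>{0..1} in lborel. g t = h t"
    by eventually_elim (auto simp: assms(4) less_le)
  then have "(LBINT t:{0..1}. g t) = (LBINT t:{0..1}. h t)"
    by (intro set_lebesgue_integral_cong_AE) simp_all
  also have "\<dots> = integral {0..1} h"
    by (intro set_borel_integral_eq_integral borel_integrable_atLeastAtMost' assms)
  finally show ?thesis .
qed

text \<open>With \<open>z = 1 - a / x\<close> the Euler factor \<open>1 - z * t\<close> is the
  harmonic denominator divided by x; the power of x that comes out cancels the one in the
  lambdas.\<close>

lemma powr_scale_denominator:
  fixes a x t \<theta> :: real
  assumes "0 < a" "0 < x" "0 \<le> t" "t \<le> 1"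
  shows "(1 - (1 - a / x) * t) powr (- (2 * \<theta>)) = x powr (2 * \<theta>) * (t * a + (1 - t) * x) powr (- (2 * \<theta>))"
proof -
  have eq: "1 - (1 - a / x) * t = (t * a + (1 - t) * x) / x"
    using assms by (simp add: field_simps)
  have "0 \<le> t * a + (1 - t) * x" using assms by simp
  then show ?thesis
    unfolding eq using assms by (simp add: powr_divide powr_minus field_simps)
qed

lemma denominator_pos:
  fixes a x t :: real
  assumes "0 < a" "0 < x" "0 \<le> t" "t \<le> 1"
  shows "0 < t * a + (1 - t) * x"
  using assms by (cases "t = 0") (auto intro!: add_pos_nonneg)

lemma continuous_on_denominator_powr:
  fixes a x r :: real
  assumes "0 < a" "0 < x"
  shows "continuous_on {0..1} (\<lambda>t. (t * a + (1 - t) * x) powr r)"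
  using denominator_pos[OF assms] by (intro continuous_on_powr' continuous_intros) (auto simp: less_imp_le less_imp_neq[symmetric])

lemma lambda1_eq:
  assumes "0 < a" "0 < x" "0 < s"
  shows "lambda1 a x s q 0 = integral {0..1} (\<lambda>t. t powr s * (t * a + (1 - t) * x) powr (- (2 * q)))"
proof -
  have "x powr (2 * q) * lambda1 a x s q 0 = Beta (s + 1) (s + 2 - (s + 1)) * hypergeom_2F1 (2 * q) (s + 1) (s + 2) (1 - a / x)"
    using assms by (simp add: lambda1_def)
  also have "\<dots> = integral {0..1} (\<lambda>t. x powr (2 * q) * (t powr s * (t * a + (1 - t) * x) powr (- (2 * q))))"
    using assms
    by (subst hypergeom_2F1_Euler, simp, simp, intro set_lborel_integral_eq_integral_continuous)
       (auto simp: powr_scale_denominator intro!: continuous_intros continuous_on_powr' continuous_on_denominator_powr)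
  finally show ?thesis using assms by simp
qed

lemma lambda2_eq:
  assumes "0 < a" "0 < x" "0 < s"
  shows "lambda2 a x s q 0 = integral {0..1} (\<lambda>t. (1 - t) powr s * (t * a + (1 - t) * x) powr (- (2 * q)))"
proof -
  have "x powr (2 * q) * lambda2 a x s q 0 = Beta 1 (s + 2 - 1) * hypergeom_2F1 (2 * q) 1 (s + 2) (1 - a / x)"
    using assms by (simp add: lambda2_def add.commute)
  also have "\<dots> = integral {0..1} (\<lambda>t. x powr (2 * q) * ((1 - t) powr s * (t * a + (1 - t) * x) powr (- (2 * q))))"
    using assms
    by (subst hypergeom_2F1_Euler, simp, simp, intro set_lborel_integral_eq_integral_continuous)
       (auto simp: powr_scale_denominator intro!: continuous_intros continuous_on_powr' continuous_on_denominator_powr)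
  finally show ?thesis using assms by simp
qed

text \<open>At the endpoint b the Euler factor is a power of \<open>t * x + (1 - t) * b\<close>.
  Replacing t by 1 - t gives the same shape as at a, so that one estimate serves both
  endpoints.\<close>

lemma lambda3_eq:
  assumes "0 < b" "0 < x" "0 < s"
  shows "lambda3 b x s q 0 = integral {0..1} (\<lambda>t. t powr s * (t * b + (1 - t) * x) powr (- (2 * q)))"
proof -
  have "b powr (2 * q) * lambda3 b x s q 0 = Beta 1 (s + 2 - 1) * hypergeom_2F1 (2 * q) 1 (s + 2) (1 - x / b)"
    using assms by (simp add: lambda3_def add.commute)
  also have "\<dots> = (LBINT t:{0..1}. (\<lambda>t. t powr (1 - 1) * (1 - t) powr (s + 2 - 1 - 1) * (1 - (1 - x / b) * t) powr (- (2 * q))) (1 - t))"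
    using assms by (subst hypergeom_2F1_Euler, simp, simp, subst set_lborel_integral_reflect) simp
  also have "\<dots> = integral {0..1} (\<lambda>t. b powr (2 * q) * (t powr s * (t * b + (1 - t) * x) powr (- (2 * q))))"
    using assms
    by (intro set_lborel_integral_eq_integral_continuous)
       (auto simp: powr_scale_denominator add.commute intro!: continuous_intros continuous_on_powr' continuous_on_denominator_powr)
  finally show ?thesis using assms by simp
qed

lemma lambda4_eq:
  assumes "0 < b" "0 < x" "0 < s"
  shows "lambda4 b x s q 0 = integral {0..1} (\<lambda>t. (1 - t) powr s * (t * b + (1 - t) * x) powr (- (2 * q)))"
proof -
  have "b powr (2 * q) * lambda4 b x s q 0 = Beta (s + 1) (s + 2 - (s + 1)) * hypergeom_2F1 (2 * q) (s + 1) (s + 2) (1 - x / b)"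
    using assms by (simp add: lambda4_def)
  also have "\<dots> = (LBINT t:{0..1}. (\<lambda>t. t powr (s + 1 - 1) * (1 - t) powr (s + 2 - (s + 1) - 1) * (1 - (1 - x / b) * t) powr (- (2 * q))) (1 - t))"
    using assms by (subst hypergeom_2F1_Euler, simp, simp, subst set_lborel_integral_reflect) simp
  also have "\<dots> = integral {0..1} (\<lambda>t. b powr (2 * q) * ((1 - t) powr s * (t * b + (1 - t) * x) powr (- (2 * q))))"
    using assms
    by (intro set_lborel_integral_eq_integral_continuous)
       (auto simp: powr_scale_denominator add.commute intro!: continuous_intros continuous_on_powr' continuous_on_denominator_powr)
  finally show ?thesis using assms by simp
qed

section \<open>The harmonic path and the substitution in the fractional integrals\<close>

text \<open>This is the argument of h in \<open>harmonically_s_convex_on\<close> for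
  \<open>u = c\<close> and \<open>v = x\<close>.\<close>

definition harmonic_path :: "real \<Rightarrow> real \<Rightarrow> real \<Rightarrow> real" where
  "harmonic_path c x t = c * x / (t * c + (1 - t) * x)"

lemma harmonic_path_inverse:
  assumes "0 < c" "0 < x"
  shows "1 / (1 / c + (1 / x - 1 / c) * t) = harmonic_path c x t"
  using assms by (simp add: harmonic_path_def field_simps)

text \<open>With d the denominator, the value is the arithmetic mean of c and x with weights
  \<open>(1 - t) * x / d\<close> and \<open>t * c / d\<close>. Using \<open>closed_segment\<close>
  leaves the order of c and x open.\<close>

lemma harmonic_path_in_segment:
  assumes "0 < c" "0 < x" "0 \<le> t" "t \<le> 1"
  shows "harmonic_path c x t \<in> closed_segment c x"
proof -
  define d u where "d = t * c + (1 - t) * x" and "u = t * c / d"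
  have d: "d > 0" unfolding d_def by (rule denominator_pos[OF assms])
  have v: "1 - u = (1 - t) * x / d"
    using d by (simp add: u_def d_def field_simps)
  have "(1 - u) * c + u * x = ((1 - t) * x * c + t * c * x) / d"
    unfolding v by (simp add: u_def add_divide_distrib)
  also have "\<dots> = harmonic_path c x t"
    by (simp add: harmonic_path_def d_def algebra_simps)
  finally have "harmonic_path c x t = (1 - u) * c + u * x" ..
  moreover have "0 \<le> u" "0 \<le> 1 - u"
    unfolding v using d assms by (simp_all add: u_def)
  ultimately show ?thesis by (auto simp: closed_segment_def)
qed

lemma harmonic_path_has_derivative:
  assumes "0 < c" "0 < x" "0 \<le> t" "t \<le> 1"
  shows "(harmonic_path c x has_real_derivative c * x * (x - c) / (t * c + (1 - t) * x)\<^sup>2) (at t within T)"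
  using denominator_pos[OF assms] unfolding harmonic_path_def[abs_def]
  by (auto intro!: derivative_eq_intros simp: power2_eq_square field_simps)

text \<open>Substitute \<open>\<tau> = 1 / c + k * t\<close> with \<open>k = 1 / x - 1 / c\<close>:
  the Jacobian gives one factor \<open>\<bar>k\<bar>\<close>, the kernel the remaining power
  \<alpha> - 1. Segment and absolute value let one formula cover both fractional integrals.\<close>

lemma RL_integral_harmonic_substitution:
  assumes "0 < c" "0 < x"
  shows "(LBINT \<tau>:closed_segment (1 / c) (1 / x). \<bar>\<tau> - 1 / c\<bar> powr (\<alpha> - 1) * f (1 / \<tau>)) =
    \<bar>1 / x - 1 / c\<bar> powr \<alpha> * (LBINT t:{0..1}. t powr (\<alpha> - 1) * f (harmonic_path c x t))"
proof (cases "x = c")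
  \<comment> \<open>The segment is a single point, where the kernel is
    \<open>0 powr (\<alpha> - 1) = 0\<close>; the right-hand side vanishes through
    \<open>0 powr \<alpha> = 0\<close>.\<close>
  case True
  have "(\<lambda>\<tau>. indicator {1 / c} \<tau> *\<^sub>R (\<bar>\<tau> - 1 / c\<bar> powr (\<alpha> - 1) * f (1 / \<tau>))) = (\<lambda>_. 0)"
    by (auto simp: fun_eq_iff indicator_def)
  then show ?thesis using True by (simp add: set_lebesgue_integral_def)
next
  case False
  define k where "k = 1 / x - 1 / c"
  have k: "k \<noteq> 0" using False assms by (simp add: k_def)
  have seg: "(1 - u) * (1 / c) + u * (1 / x) = 1 / c + k * u" for u
    by (simp add: k_def diff_divide_distrib left_diff_distrib)
  \<comment> \<open>As k is nonzero, t is determined by its image, so the segment pulls back exactly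
    to the unit interval.\<close>
  have ind: "indicator (closed_segment (1 / c) (1 / x)) (1 / c + k * t) = (indicator {0..1} t :: real)" for t
  proof -
    have "1 / c + k * t \<in> closed_segment (1 / c) (1 / x) \<longleftrightarrow> t \<in> {0..1}"
    proof
      assume "1 / c + k * t \<in> closed_segment (1 / c) (1 / x)"
      then obtain u where u: "0 \<le> u" "u \<le> 1" "1 / c + k * t = (1 - u) * (1 / c) + u * (1 / x)"
        by (auto simp: closed_segment_def)
      then have "k * t = k * u" by (simp only: seg add_left_cancel)
      then show "t \<in> {0..1}" using k u by simp
    next
      assume "t \<in> {0..1}"
      then show "1 / c + k * t \<in> closed_segment (1 / c) (1 / x)"
        by (auto simp: closed_segment_def seg[symmetric] simp del: times_divide_eq_right)
    qed
    then show ?thesis by (auto simp: indicator_def)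
  qed
  have "(LBINT \<tau>:closed_segment (1 / c) (1 / x). \<bar>\<tau> - 1 / c\<bar> powr (\<alpha> - 1) * f (1 / \<tau>)) =
      \<bar>k\<bar> * (LBINT t. indicator {0..1} t * (\<bar>k * t\<bar> powr (\<alpha> - 1) * f (1 / (1 / c + k * t))))"
    unfolding set_lebesgue_integral_def
    by (subst lborel_integral_real_affine[OF k, of _ "1 / c"]) (simp add: ind)
  also have "(\<lambda>t. indicator {0..1} t * (\<bar>k * t\<bar> powr (\<alpha> - 1) * f (1 / (1 / c + k * t)))) =
      (\<lambda>t. \<bar>k\<bar> powr (\<alpha> - 1) * (indicator {0..1} t *\<^sub>R (t powr (\<alpha> - 1) * f (harmonic_path c x t))))"
    unfolding k_def harmonic_path_inverse[OF assms]
    by (auto simp: fun_eq_iff indicator_def abs_mult powr_mult)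
  also have "\<bar>k\<bar> * (LBINT t. \<dots> t) = \<bar>k\<bar> powr \<alpha> * (LBINT t:{0..1}. t powr (\<alpha> - 1) * f (harmonic_path c x t))"
  proof -
    have "\<bar>k\<bar> * \<bar>k\<bar> powr (\<alpha> - 1) = \<bar>k\<bar> powr \<alpha>"
      using k by (simp add: powr_diff)
    then show ?thesis
      unfolding set_lebesgue_integral_def integral_mult_right_zero by (simp only: mult.assoc[symmetric])
  qed
  finally show ?thesis by (simp add: k_def)
qed

section \<open>The estimate for one endpoint\<close>

text \<open>Meant for the kernel exponent \<open>\<beta> = \<alpha> - 1\<close>, singular at 0 when
  \<alpha> < 1: \<open>t powr \<beta>\<close> is absolutely integrable and \<phi> is bounded on the
  compact interval.\<close>

lemma powr_times_continuous_integrable: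
  fixes \<phi> :: "real \<Rightarrow> real"
  assumes "\<beta> > -1" and \<phi>: "continuous_on {0..1} \<phi>"
  shows "set_integrable lborel {0..1} (\<lambda>t. t powr \<beta> * \<phi> t)"
proof -
  have "(\<lambda>t. t powr \<beta>) absolutely_integrable_on {0..1}"
    by (intro nonnegative_absolutely_integrable_1 integrable_on_powr_from_0) (use assms in auto)
  then have "(\<lambda>t. \<phi> t * t powr \<beta>) absolutely_integrable_on {0..1}"
    by (intro absolutely_integrable_bounded_measurable_product_real)
       (auto intro!: continuous_imp_measurable_on_sets_lebesgue \<phi> compact_imp_bounded compact_continuous_image)
  \<comment> \<open>Absolute integrability refers to the completed measure; Borel measurability
    brings it back to \<open>lborel\<close>.\<close>
  moreover have "(\<lambda>t. indicator {0..1} t *\<^sub>R (t powr \<beta> * \<phi> t)) \<in> borel_measurable lborel"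
  proof -
    have "(\<lambda>t. t powr \<beta> * (indicator {0..1} t *\<^sub>R \<phi> t)) \<in> borel_measurable lborel"
      using borel_measurable_continuous_on_indicator[OF _ \<phi>] by measurable
    then show ?thesis by (simp add: mult.left_commute)
  qed
  ultimately show ?thesis
    unfolding set_integrable_def by (subst (asm) integrable_completion) (simp_all add: mult.commute)
qed

text \<open>\<open>X\<close> and \<open>Y\<close> stand for \<open>\<bar>f' x\<bar> powr q\<close>
  and \<open>\<bar>f' c\<bar> powr q\<close>, and c for either endpoint. Derivatives within the
  segment admit one-sided ones at its ends.\<close>

lemma one_sided_estimate:
  fixes f f' :: "real \<Rightarrow> real"
  assumes pos: "0 < c" "0 < x" "0 < \<alpha>" "0 < s"
    and pq: "p > 1" "q > 1" "1 / p + 1 / q = 1"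
    and deriv: "\<And>y. y \<in> closed_segment c x \<Longrightarrow>
      (f has_real_derivative f' y) (at y within closed_segment c x)"
    and bound: "\<And>t. 0 \<le> t \<Longrightarrow> t \<le> 1 \<Longrightarrow>
      \<bar>f' (harmonic_path c x t)\<bar> powr q \<le> t powr s * X + (1 - t) powr s * Y"
    and nn: "0 \<le> X" "0 \<le> Y"
  shows "\<bar>(\<bar>x - c\<bar> / (c * x)) powr \<alpha> * f x
      - \<alpha> * (LBINT \<tau>:closed_segment (1 / c) (1 / x). \<bar>\<tau> - 1 / c\<bar> powr (\<alpha> - 1) * f (1 / \<tau>))\<bar>
    \<le> (1 / (\<alpha> * p + 1)) powr (1 / p) * (\<bar>x - c\<bar> powr (\<alpha> + 1) / (c * x) powr (\<alpha> - 1) *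
        (integral {0..1} (\<lambda>t. t powr s * (t * c + (1 - t) * x) powr (- (2 * q))) * X
         + integral {0..1} (\<lambda>t. (1 - t) powr s * (t * c + (1 - t) * x) powr (- (2 * q))) * Y) powr (1 / q))"
proof -
  \<comment> \<open>\<open>D\<close> will be the derivative of \<open>\<phi>\<close>, and
    \<open>W\<close> is the convexity bound for the q-th power. On the unit interval
    \<open>h\<close> is a continuous majorant of \<open>\<bar>D\<bar>\<close> up to the constant
    \<open>c * x * \<bar>x - c\<bar>\<close>.\<close>
  define A where "A t = t * c + (1 - t) * x" for t
  define \<phi> where "\<phi> t = f (harmonic_path c x t)" for t
  define D where "D t = f' (harmonic_path c x t) * (c * x * (x - c) / (A t)\<^sup>2)" for t
  define W where "W t = t powr s * X + (1 - t) powr s * Y" for t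
  define h where "h t = A t powr (- 2) * W t powr (1 / q)" for t
  define J where "J = (LBINT t:{0..1}. t powr (\<alpha> - 1) * \<phi> t)"
  have A: "A t > 0" if "0 \<le> t" "t \<le> 1" for t
    unfolding A_def by (intro denominator_pos pos that)
  have W: "W t \<ge> 0" for t using nn by (simp add: W_def)
  have der: "(\<phi> has_real_derivative D t) (at t within {0..1})" if "t \<in> {0..1}" for t
  proof -
    have "(f has_real_derivative f' (harmonic_path c x t))
        (at (harmonic_path c x t) within harmonic_path c x ` {0..1})"
      by (rule DERIV_subset[OF deriv]) (use that pos harmonic_path_in_segment in auto)
    from DERIV_image_chain[OF this harmonic_path_has_derivative] that pos
    show ?thesis by (simp add: \<phi>_def[abs_def] D_def A_def o_def)
  qed
  have cont: "continuous_on {0..1} \<phi>"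
    by (rule DERIV_continuous_on[OF der])
  have contW: "continuous_on {0..1} W"
    unfolding W_def using pos by (intro continuous_intros continuous_on_powr') auto
  have contA: "continuous_on {0..1} (\<lambda>t. A t powr r)" for r
    unfolding A_def by (intro continuous_on_denominator_powr pos)
  have conth: "continuous_on {0..1} h"
    unfolding h_def using pq W by (intro continuous_intros continuous_on_powr' contA contW) auto
  have contpow: "continuous_on {0..1} (\<lambda>t::real. t powr r)" if "r > 0" for r
    using that by (intro continuous_on_powr' continuous_intros) auto

  \<comment> \<open>Integration by parts: \<open>t powr \<alpha> * \<phi> t\<close> vanishes at 0
    and is \<open>f x\<close> at 1. Differentiability is required only in the interior, since the
    derivative may be singular at 0 when \<alpha> < 1.\<close>
  have FTC: "((\<lambda>t. \<alpha> * (t powr (\<alpha> - 1) * \<phi> t) + t powr \<alpha> * D t) has_integral 1 powr \<alpha> * \<phi> 1 - 0 powr \<alpha> * \<phi> 0) {0..1}"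
  proof (rule fundamental_theorem_of_calculus_interior)
    show "continuous_on {0..1} (\<lambda>t. t powr \<alpha> * \<phi> t)"
      using pos by (intro continuous_intros cont contpow)
    fix t :: real assume t: "t \<in> {0<..<1}"
    have "(\<phi> has_real_derivative D t) (at t)"
      using der[of t] t at_within_interior[of t "{0..1}"] by simp
    then have "((\<lambda>t. t powr \<alpha> * \<phi> t) has_real_derivative \<alpha> * (t powr (\<alpha> - 1) * \<phi> t) + t powr \<alpha> * D t) (at t)"
      using t by (auto intro!: derivative_eq_intros has_real_derivative_powr simp: algebra_simps)
    then show "((\<lambda>t. t powr \<alpha> * \<phi> t) has_vector_derivative \<alpha> * (t powr (\<alpha> - 1) * \<phi> t) + t powr \<alpha> * D t) (at t)"
      by (simp add: has_real_derivative_iff_has_vector_derivative)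
  qed simp
  have "((\<lambda>t. t powr (\<alpha> - 1) * \<phi> t) has_integral J) {0..1}"
    using set_borel_integral_eq_integral[OF powr_times_continuous_integrable[OF _ cont, of "\<alpha> - 1"]] pos
    unfolding J_def by (simp add: has_integral_integral)
  \<comment> \<open>Subtraction yields both existence and value of the integral of
    \<open>t powr \<alpha> * D t\<close>.\<close>
  from has_integral_diff[OF FTC has_integral_mult_right[OF this, of \<alpha>]]
  have intD: "((\<lambda>t. t powr \<alpha> * D t) has_integral f x - \<alpha> * J) {0..1}"
    using pos by (simp add: \<phi>_def harmonic_path_def)

  have absD: "\<bar>t powr \<alpha> * D t\<bar> \<le> c * x * \<bar>x - c\<bar> * (t powr \<alpha> * h t)" if t: "t \<in> {0..1}" for t
  proof -
    have "\<bar>f' (harmonic_path c x t)\<bar> = (\<bar>f' (harmonic_path c x t)\<bar> powr q) powr (1 / q)"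
      using pq by (simp add: powr_powr)
    also have "\<dots> \<le> W t powr (1 / q)"
      unfolding W_def using pq t by (intro powr_mono2 bound) auto
    finally have "t powr \<alpha> * (c * x * \<bar>x - c\<bar> * (A t powr (- 2) * \<bar>f' (harmonic_path c x t)\<bar>))
        \<le> t powr \<alpha> * (c * x * \<bar>x - c\<bar> * (A t powr (- 2) * W t powr (1 / q)))"
      using pos by (intro mult_left_mono) auto
    moreover have "A t powr (- 2) = 1 / (A t)\<^sup>2"
      using A[of t] t by (simp add: powr_minus powr_numeral divide_inverse)
    ultimately show ?thesis
      using pos by (simp add: D_def h_def abs_mult mult_ac)
  qed
  have inth: "(\<lambda>t. t powr \<alpha> * h t) integrable_on {0..1}"
    by (intro integrable_continuous_real continuous_intros conth contpow pos)
  have "\<bar>f x - \<alpha> * J\<bar> \<le> integral {0..1} (\<lambda>t. c * x * \<bar>x - c\<bar> * (t powr \<alpha> * h t))"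
    unfolding integral_unique[OF intD, symmetric] real_norm_def[symmetric]
    by (rule integral_norm_bound_integral[OF has_integral_integrable[OF intD] integrable_on_mult_right[OF inth]])
       (simp only: real_norm_def absD)
  also have "\<dots> = c * x * \<bar>x - c\<bar> * integral {0..1} (\<lambda>t. t powr \<alpha> * h t)"
    by simp
  \<comment> \<open>The whole weight \<open>A t powr (- 2)\<close> stays in the factor raised to q
    and becomes \<open>A t powr (- (2 * q))\<close>; hence the lambdas occur with \<theta> = q and
    \<rho> = 0.\<close>
  also have "integral {0..1} (\<lambda>t. t powr \<alpha> * h t) \<le>
      integral {0..1} (\<lambda>t. (t powr \<alpha>) powr p) powr (1 / p) * integral {0..1} (\<lambda>t. h t powr q) powr (1 / q)"
  proof (rule Holder_inequality_integral[OF pq inth])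
    show "(\<lambda>t. (t powr \<alpha>) powr p) integrable_on {0..1}"
      unfolding powr_powr using pos pq by (intro integrable_continuous_real contpow) auto
    show "(\<lambda>t. h t powr q) integrable_on {0..1}"
      using pq by (intro integrable_continuous_real continuous_on_powr' conth continuous_intros) (auto simp: h_def)
  qed (auto simp: h_def)
  also have "integral {0..1} (\<lambda>t. (t powr \<alpha>) powr p) = 1 / (\<alpha> * p + 1)"
    unfolding powr_powr using has_integral_powr_from_0[of "\<alpha> * p" 1] pos pq
    by (auto intro!: integral_unique simp: less_le_trans[of _ 0])
  also have "integral {0..1} (\<lambda>t. h t powr q) = integral {0..1} (\<lambda>t. t powr s * A t powr (- (2 * q)) * X + (1 - t) powr s * A t powr (- (2 * q)) * Y)"
  proof (rule integral_cong)
    fix t :: real assume t: "t \<in> {0..1}"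
    have "h t powr q = A t powr (- (2 * q)) * W t"
      using pq W[of t] by (simp add: h_def powr_mult powr_powr)
    then show "h t powr q = t powr s * A t powr (- (2 * q)) * X + (1 - t) powr s * A t powr (- (2 * q)) * Y"
      by (simp add: W_def algebra_simps)
  qed
  also have "\<dots> = integral {0..1} (\<lambda>t. t powr s * A t powr (- (2 * q))) * X
         + integral {0..1} (\<lambda>t. (1 - t) powr s * A t powr (- (2 * q))) * Y" (is "_ = ?L")
    using pos by (subst integral_add)
      (auto intro!: integrable_continuous_real continuous_intros contA contpow continuous_on_powr')
  finally have main: "\<bar>f x - \<alpha> * J\<bar> \<le> c * x * \<bar>x - c\<bar> * ((1 / (\<alpha> * p + 1)) powr (1 / p) * ?L powr (1 / q))"
    using pos by (simp add: mult_left_mono)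

  \<comment> \<open>\<open>r\<close> is the distance between \<open>1 / c\<close> and
    \<open>1 / x\<close>; multiplying \<open>main\<close> by \<open>r powr \<alpha>\<close> restores
    the factor split off by the substitution.\<close>
  define r where "r = \<bar>x - c\<bar> / (c * x)"
  have r: "\<bar>1 / x - 1 / c\<bar> = r" "r \<ge> 0"
  proof -
    have "1 / x - 1 / c = (c - x) / (c * x)" using pos by (simp add: field_simps)
    then show "\<bar>1 / x - 1 / c\<bar> = r" using pos by (simp add: r_def abs_mult abs_minus_commute)
  qed (use pos in \<open>simp add: r_def\<close>)
  have coeff: "r powr \<alpha> * (c * x * \<bar>x - c\<bar>) = \<bar>x - c\<bar> powr (\<alpha> + 1) / (c * x) powr (\<alpha> - 1)"
    using pos by (simp add: r_def powr_divide powr_add powr_diff field_simps)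
  have "\<bar>r powr \<alpha> * f x - \<alpha> * (r powr \<alpha> * J)\<bar> = r powr \<alpha> * \<bar>f x - \<alpha> * J\<bar>"
  proof -
    have "r powr \<alpha> * f x - \<alpha> * (r powr \<alpha> * J) = r powr \<alpha> * (f x - \<alpha> * J)" by (simp add: algebra_simps)
    then show ?thesis by (simp add: abs_mult)
  qed
  also have "\<dots> \<le> r powr \<alpha> * (c * x * \<bar>x - c\<bar> * ((1 / (\<alpha> * p + 1)) powr (1 / p) * ?L powr (1 / q)))"
    by (intro mult_left_mono main) simp
  also have "\<dots> = (1 / (\<alpha> * p + 1)) powr (1 / p) * ((r powr \<alpha> * (c * x * \<bar>x - c\<bar>)) * ?L powr (1 / q))"
    by (simp add: mult_ac)
  finally show ?thesis
    unfolding coeff RL_integral_harmonic_substitution[OF pos(1,2)] r(1)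
    unfolding r_def A_def J_def \<phi>_def .
qed

section \<open>Combining the estimates at a and b\<close>

theorem theorem11:
  fixes I :: "real set" and f f' :: "real \<Rightarrow> real" and a b \<alpha> s p q :: real
  assumes "is_interval I" and "I \<subseteq> {0<..}"
    and "a \<in> I" and "b \<in> I" and "a < b"
    and "\<And>y. y \<in> interior I \<Longrightarrow> (f has_real_derivative f' y) (at y)"
    and "\<And>y. y \<in> {a, b} \<Longrightarrow> (f has_real_derivative f' y) (at y within I)"
    and "f' absolutely_integrable_on {a..b}"
    and "\<alpha> > 0" and "s \<in> {0<..1}" and "q > 1" and "1 / p + 1 / q = 1"
    and "harmonically_s_convex_on s {a..b} (\<lambda>y. \<bar>f' y\<bar> powr q)"
  shows "\<forall>x\<in>{a..b}.
    \<bar>S_func f (\<lambda>u. 1 / u) \<alpha> x a b\<bar> \<le>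
      (1 / (\<alpha> * p + 1)) powr (1 / p) *
      ((x - a) powr (\<alpha> + 1) / (a * x) powr (\<alpha> - 1) *
         (lambda1 a x s q 0 * \<bar>f' x\<bar> powr q + lambda2 a x s q 0 * \<bar>f' a\<bar> powr q) powr (1 / q)
       + (b - x) powr (\<alpha> + 1) / (b * x) powr (\<alpha> - 1) *
         (lambda3 b x s q 0 * \<bar>f' x\<bar> powr q + lambda4 b x s q 0 * \<bar>f' b\<bar> powr q) powr (1 / q))"
proof
  fix x assume x: "x \<in> {a..b}"
  have ab: "0 < a" "0 < x" "0 < b" using assms(2,3) x by auto
  have as: "0 < \<alpha>" "0 < s" using assms(9,10) by auto
  have p: "p > 1"
  proof -
    have "1 / p = 1 - 1 / q" using assms(12) by simp
    then have "0 < 1 / p" "1 / p < 1" using assms(11) by auto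
    then show ?thesis by (simp only: zero_less_divide_1_iff divide_less_eq_1_pos)
  qed
  note pq = p assms(11,12)
  have sub: "{a..b} \<subseteq> I"
    using assms(1,3,4) unfolding is_interval_1 subset_iff atLeastAtMost_iff by blast
  \<comment> \<open>The derivatives at a and b restrict from \<open>I\<close> to
    \<open>{a..b}\<close>; every other point is interior to \<open>{a..b}\<close>, hence to
    \<open>I\<close>.\<close>
  have der: "(f has_real_derivative f' y) (at y within {a..b})" if y: "y \<in> {a..b}" for y
  proof (cases "y \<in> {a, b}")
    case True
    then show ?thesis by (rule DERIV_subset[OF assms(7) sub])
  next
    case False
    then have "y \<in> interior {a..b}" using y by auto
    then have "y \<in> interior I" using interior_mono[OF sub] by blast
    then show ?thesis by (rule has_field_derivative_at_within[OF assms(6)])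
  qed
  have conv: "\<bar>f' (harmonic_path c x t)\<bar> powr q \<le> t powr s * \<bar>f' x\<bar> powr q + (1 - t) powr s * \<bar>f' c\<bar> powr q"
    if "c \<in> {a..b}" "0 \<le> t" "t \<le> 1" for c t
  proof -
    have "t \<in> {0..1}" using that by simp
    then show ?thesis
      using assms(13)[unfolded harmonically_s_convex_on_def, rule_format, OF that(1) x]
      unfolding harmonic_path_def by blast
  qed
  have est: "\<bar>(\<bar>x - c\<bar> / (c * x)) powr \<alpha> * f x
      - \<alpha> * (LBINT \<tau>:closed_segment (1 / c) (1 / x). \<bar>\<tau> - 1 / c\<bar> powr (\<alpha> - 1) * f (1 / \<tau>))\<bar>
    \<le> (1 / (\<alpha> * p + 1)) powr (1 / p) * (\<bar>x - c\<bar> powr (\<alpha> + 1) / (c * x) powr (\<alpha> - 1) *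
        (integral {0..1} (\<lambda>t. t powr s * (t * c + (1 - t) * x) powr (- (2 * q))) * \<bar>f' x\<bar> powr q
         + integral {0..1} (\<lambda>t. (1 - t) powr s * (t * c + (1 - t) * x) powr (- (2 * q))) * \<bar>f' c\<bar> powr q) powr (1 / q))"
    if c: "c \<in> {a..b}" for c
  proof (rule one_sided_estimate[OF _ ab(2) as pq])
    have seg: "closed_segment c x \<subseteq> {a..b}"
      using c x by (auto simp: closed_segment_eq_real_ivl split: if_splits)
    show "(f has_real_derivative f' y) (at y within closed_segment c x)" if "y \<in> closed_segment c x" for y
      using that seg by (intro DERIV_subset[OF der seg] subsetD[OF seg])
    show "\<bar>f' (harmonic_path c x t)\<bar> powr q \<le> t powr s * \<bar>f' x\<bar> powr q + (1 - t) powr s * \<bar>f' c\<bar> powr q"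
      if "0 \<le> t" "t \<le> 1" for t
      by (rule conv[OF c that])
  qed (use c ab in simp_all)
  \<comment> \<open>The quotient of \<open>Gamma (\<alpha> + 1)\<close> by
    \<open>Gamma \<alpha>\<close> supplies the factor \<alpha> in front of the integrals in
    \<open>est\<close>.\<close>
  have "\<alpha> \<notin> \<int>\<^sub>\<le>\<^sub>0" using as by (auto elim!: nonpos_Ints_cases)
  then have Gam: "Gamma (\<alpha> + 1) = \<alpha> * Gamma \<alpha>" "Gamma \<alpha> > 0"
    using as by (simp_all add: Gamma_plus1)
  have inv: "1 / b \<le> 1 / x" "1 / x \<le> 1 / a"
    using x ab by (simp_all add: frac_le)
  have abs: "\<bar>x - a\<bar> = x - a" "\<bar>x - b\<bar> = b - x"
    using x by auto
  \<comment> \<open>Reciprocals reverse the order, so the segment from \<open>1 / b\<close> carries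
    the right-sided integral and the one from \<open>1 / a\<close> the left-sided; the absolute
    value resolves to the respective kernel.\<close>
  let ?R = "\<lambda>c. LBINT \<tau>:closed_segment (1 / c) (1 / x). \<bar>\<tau> - 1 / c\<bar> powr (\<alpha> - 1) * f (1 / \<tau>)"
  have "RL_right \<alpha> (1 / x) (f \<circ> (\<lambda>u. 1 / u)) (1 / b) = 1 / Gamma \<alpha> * ?R b"
  proof -
    have "closed_segment (1 / b) (1 / x) = {1 / b..1 / x}"
      using inv by (simp only: closed_segment_eq_real_ivl if_True)
    then show ?thesis
      unfolding RL_right_def set_lebesgue_integral_def
      by (intro arg_cong[of _ _ "\<lambda>r. 1 / Gamma \<alpha> * r"] Bochner_Integration.integral_cong) (auto simp: indicator_def)
  qed
  moreover have "RL_left \<alpha> (1 / x) (f \<circ> (\<lambda>u. 1 / u)) (1 / a) = 1 / Gamma \<alpha> * ?R a"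
  proof -
    have "closed_segment (1 / a) (1 / x) = {1 / x..1 / a}"
      using inv by (subst closed_segment_commute) (simp only: closed_segment_eq_real_ivl if_True)
    then show ?thesis
      unfolding RL_left_def set_lebesgue_integral_def
      by (intro arg_cong[of _ _ "\<lambda>r. 1 / Gamma \<alpha> * r"] Bochner_Integration.integral_cong) (auto simp: indicator_def)
  qed
  moreover have "Gamma (\<alpha> + 1) * (1 / Gamma \<alpha> * u + 1 / Gamma \<alpha> * v) = \<alpha> * u + \<alpha> * v" for u v
    using Gam by (simp add: field_simps)
  \<comment> \<open>One bracket per endpoint, each in the form bounded by \<open>est\<close>; the
    triangle inequality then finishes the proof.\<close>
  ultimately have S: "S_func f (\<lambda>u. 1 / u) \<alpha> x a b =
      ((\<bar>x - a\<bar> / (a * x)) powr \<alpha> * f x - \<alpha> * ?R a) + ((\<bar>x - b\<bar> / (b * x)) powr \<alpha> * f x - \<alpha> * ?R b)"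
    unfolding S_func_def by (simp add: abs distrib_right)
  show "\<bar>S_func f (\<lambda>u. 1 / u) \<alpha> x a b\<bar> \<le>
      (1 / (\<alpha> * p + 1)) powr (1 / p) *
      ((x - a) powr (\<alpha> + 1) / (a * x) powr (\<alpha> - 1) *
         (lambda1 a x s q 0 * \<bar>f' x\<bar> powr q + lambda2 a x s q 0 * \<bar>f' a\<bar> powr q) powr (1 / q)
       + (b - x) powr (\<alpha> + 1) / (b * x) powr (\<alpha> - 1) *
         (lambda3 b x s q 0 * \<bar>f' x\<bar> powr q + lambda4 b x s q 0 * \<bar>f' b\<bar> powr q) powr (1 / q))"
    unfolding S distrib_left lambda1_eq[OF ab(1,2) as(2)] lambda2_eq[OF ab(1,2) as(2)]
      lambda3_eq[OF ab(3,2) as(2)] lambda4_eq[OF ab(3,2) as(2)]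
    using order.trans[OF abs_triangle_ineq add_mono[OF est[of a] est[of b]]] assms(5)
    by (simp only: abs atLeastAtMost_iff order.refl less_imp_le simp_thms True_implies_equals)
qed

end
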